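(* Let $R>0$, let $d\ge 1$ be an integer, and let $0<\gamma_0<\gamma_1<\dots<\gamma_d=1$. Let $f:(-R,R)\to\mathbb{R}$ be an $(M_1,M_2)$-diffeomorphism, and put $C_1:=3M_1M_2$ and $C_2:=M_2(M_1^2+M_1)$. For $1\le k\le d$ let $\Delta_k:=f_{[\gamma_k]}\circ f_{[\gamma_{k-1}]}^{-1}$ and $\psi_k(x):=\Delta_k(x)-x$, both defined on $D_k:=f_{[\gamma_{k-1}]}((-R,R))$. Then for all $1\le k\le d$ the function $\psi_k$ is $C_1R(\gamma_k-\gamma_{k-1})$-Lipschitz and $C_2$-smooth on $D_k$.
   Context: A differentiable function $g$ on a subset of $\mathbb{R}$ is $M$-Lipschitz if $|g(x)-g(y)|\le M|x-y|$ for all $x,y$ in its domain, and $M$-smooth if its derivative $g'$ is $M$-Lipschitz. A function $f:(-R,R)\to\mathbb{R}$ is an $(M_1,M_2)$-diffeomorphism if it is invertible onto its image and both $f$ and its inverse $f^{-1}:f((-R,R))\to(-R,R)$ are twice differentiable, $M_1$-Lipschitz and $M_2$-smooth. For $0<\gamma\le 1$, the dilation of $f$ at scale $\gamma$ is $f_{[\gamma]}(x):=f(\gamma x)/\gamma$, considered for $x\in(-R,R)$; it is invertible onto its image, with inverse $f_{[\gamma]}^{-1}(x)=f^{-1}(\gamma x)/\gamma$. *)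

theory Defs
  imports "HOL-Analysis.Lipschitz" "HOL-Analysis.Derivative"
begin

text \<open>
  A partial function with domain \<open>S\<close> is represented by a total function of which only the
  values on \<open>S\<close> matter; derivatives are therefore taken within \<open>S\<close>. The derivative is unique
  if \<open>S\<close> has no isolated points, and it is the usual two-sided one if \<open>S\<close> is open.
\<close>

definition is_derivative_on :: "real set \<Rightarrow> (real \<Rightarrow> real) \<Rightarrow> (real \<Rightarrow> real) \<Rightarrow> bool" where
  "is_derivative_on S g g' \<longleftrightarrow> (\<forall>x\<in>S. (g has_real_derivative g' x) (at x within S))"

definition twice_differentiable_on :: "real set \<Rightarrow> (real \<Rightarrow> real) \<Rightarrow> bool" where
  "twice_differentiable_on S g \<longleftrightarrow>
     (\<exists>g' g''. is_derivative_on S g g' \<and> is_derivative_on S g' g'')"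

definition lipschitz_smooth_on :: "real \<Rightarrow> real set \<Rightarrow> (real \<Rightarrow> real) \<Rightarrow> bool" where
  "lipschitz_smooth_on M S g \<longleftrightarrow> (\<exists>g'. is_derivative_on S g g' \<and> M-lipschitz_on S g')"

definition diffeomorphism_on_interval ::
    "real \<Rightarrow> real \<Rightarrow> real \<Rightarrow> (real \<Rightarrow> real) \<Rightarrow> bool" where
  "diffeomorphism_on_interval M1 M2 R f \<longleftrightarrow>
     (let I = {-R<..<R}; J = f ` I; h = inv_into I f in
        inj_on f I \<and>
        twice_differentiable_on I f \<and> M1-lipschitz_on I f \<and> lipschitz_smooth_on M2 I f \<and>
        twice_differentiable_on J h \<and> M1-lipschitz_on J h \<and> lipschitz_smooth_on M2 J h)"

definition dilation :: "(real \<Rightarrow> real) \<Rightarrow> real \<Rightarrow> real \<Rightarrow> real" where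
  "dilation f c x = f (c * x) / c"

definition Delta :: "real \<Rightarrow> (real \<Rightarrow> real) \<Rightarrow> (nat \<Rightarrow> real) \<Rightarrow> nat \<Rightarrow> real \<Rightarrow> real" where
  "Delta R f \<gamma> k = dilation f (\<gamma> k) \<circ> inv_into {-R<..<R} (dilation f (\<gamma> (k - 1)))"

definition psi :: "real \<Rightarrow> (real \<Rightarrow> real) \<Rightarrow> (nat \<Rightarrow> real) \<Rightarrow> nat \<Rightarrow> real \<Rightarrow> real" where
  "psi R f \<gamma> k x = Delta R f \<gamma> k x - x"

definition Dom :: "real \<Rightarrow> (real \<Rightarrow> real) \<Rightarrow> (nat \<Rightarrow> real) \<Rightarrow> nat \<Rightarrow> real set" where
  "Dom R f \<gamma> k = dilation f (\<gamma> (k - 1)) ` {-R<..<R}"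

end

theory Submission
  imports Defs
begin

text \<open>
  Write \<open>h\<close> for the inverse of \<open>f\<close>, \<open>a = \<gamma>\<^sub>k\<^sub>-\<^sub>1\<close>, \<open>b = \<gamma>\<^sub>k\<close> and \<open>u\<close> for the inverse of the dilation
  at scale \<open>a\<close>, so that \<open>u y = h (a y) / a\<close>. The chain rule gives \<open>\<Delta>' y = f' (b u) h' (a y)\<close>, and
  \<open>f' (a u) h' (a y) = 1\<close>, whence \<open>\<psi>' y = (f' (b u) - f' (a u)) h' (a y)\<close>. As \<open>\<bar>u\<bar> < R\<close>, this is
  at most \<open>M\<^sub>1 M\<^sub>2 R (b - a)\<close> in absolute value, a third of what is claimed. For the smoothness,
  \<open>f' (b u)\<close> and \<open>h' (a y)\<close> are bounded by \<open>M\<^sub>1\<close> and Lipschitz in \<open>y\<close> with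
  constants \<open>b M\<^sub>1 M\<^sub>2\<close> and \<open>a M\<^sub>2\<close>, so their product is Lipschitz with constant
  \<open>b M\<^sub>1\<^sup>2 M\<^sub>2 + a M\<^sub>1 M\<^sub>2\<close>.
\<close>

text \<open>Every difference quotient is at most \<open>M\<close> in absolute value, and the bound
  passes to the limit. The filter has to be nontrivial: at an isolated point of \<open>S\<close>
  every number is a derivative within \<open>S\<close>.\<close>

lemma lipschitz_on_derivative_bound:
  fixes g :: "real \<Rightarrow> real"
  assumes lip: "M-lipschitz_on S g"
    and der: "(g has_real_derivative g') (at x within S)"
    and x: "x \<in> S" and nt: "at x within S \<noteq> bot"
  shows "\<bar>g'\<bar> \<le> M"
proof (rule tendsto_upperbound[OF _ _ nt])
  show "((\<lambda>y. \<bar>(g y - g x) / (y - x)\<bar>) \<longlongrightarrow> \<bar>g'\<bar>) (at x within S)"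
    using der by (intro tendsto_rabs) (simp add: has_field_derivative_iff)
  show "\<forall>\<^sub>F y in at x within S. \<bar>(g y - g x) / (y - x)\<bar> \<le> M"
  proof (subst eventually_at_filter, rule always_eventually, intro allI impI)
    fix y assume "y \<noteq> x" "y \<in> S"
    then show "\<bar>(g y - g x) / (y - x)\<bar> \<le> M"
      using lipschitz_onD[OF lip \<open>y \<in> S\<close> x] by (simp add: dist_real_def divide_simps)
  qed
qed

lemma lipschitz_on_mult_bounded:
  fixes p q :: "real \<Rightarrow> real"
  assumes p: "P-lipschitz_on S p" and q: "Q-lipschitz_on S q"
    and bp: "\<And>x. x \<in> S \<Longrightarrow> \<bar>p x\<bar> \<le> B" and bq: "\<And>x. x \<in> S \<Longrightarrow> \<bar>q x\<bar> \<le> C"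
    and "0 \<le> B" "0 \<le> C"
  shows "(P * C + B * Q)-lipschitz_on S (\<lambda>x. p x * q x)"
proof (rule lipschitz_onI)
  have PQ: "0 \<le> P" "0 \<le> Q"
    using p q lipschitz_on_nonneg by blast+
  then show "0 \<le> P * C + B * Q"
    using assms(5,6) by simp
  fix x y assume xy: "x \<in> S" "y \<in> S"
  have "p x * q x - p y * q y = (p x - p y) * q x + p y * (q x - q y)"
    by algebra
  then have "\<bar>p x * q x - p y * q y\<bar> \<le> \<bar>p x - p y\<bar> * \<bar>q x\<bar> + \<bar>p y\<bar> * \<bar>q x - q y\<bar>"
    by (metis abs_mult abs_triangle_ineq)
  also have "\<dots> \<le> (P * \<bar>x - y\<bar>) * C + B * (Q * \<bar>x - y\<bar>)"
    using lipschitz_onD[OF p xy] lipschitz_onD[OF q xy] bp[of y] bq[of x] xy PQ assms(5,6)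
    by (intro add_mono mult_mono) (auto simp: dist_real_def)
  finally show "dist (p x * q x) (p y * q y) \<le> (P * C + B * Q) * dist x y"
    by (simp add: dist_real_def algebra_simps)
qed

text \<open>Each claim of the theorem involves only two consecutive scales, so the sequence is
  replaced here by two numbers \<open>0 < a \<le> b \<le> 1\<close>.\<close>

lemma dilation_quotient:
  fixes f :: "real \<Rightarrow> real"
  assumes R: "0 < R" and a: "0 < a" and ab: "a \<le> b" and b: "b \<le> 1"
    and diffeo: "diffeomorphism_on_interval M1 M2 R f"
  defines "I \<equiv> {-R<..<R}"
  defines "D \<equiv> dilation f a ` I" and "u \<equiv> inv_into I (dilation f a)"
  defines "\<psi> \<equiv> \<lambda>y. dilation f b (u y) - y"
  shows "(3 * M1 * M2 * R * (b - a))-lipschitz_on D \<psi>"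
    and "lipschitz_smooth_on (M2 * (M1\<^sup>2 + M1)) D \<psi>"
proof -
  define J where "J = f ` I"
  define h where "h = inv_into I f"
  have inj: "inj_on f I" and lf: "M1-lipschitz_on I f" and lh: "M1-lipschitz_on J h"
    and sf: "lipschitz_smooth_on M2 I f" and sh: "lipschitz_smooth_on M2 J h"
    using diffeo unfolding diffeomorphism_on_interval_def Let_def I_def J_def h_def by blast+
  from sf obtain f' where
    f': "\<And>x. x \<in> I \<Longrightarrow> (f has_real_derivative f' x) (at x within I)" and lf': "M2-lipschitz_on I f'"
    unfolding lipschitz_smooth_on_def is_derivative_on_def by blast
  from sh obtain h' where
    h': "\<And>y. y \<in> J \<Longrightarrow> (h has_real_derivative h' y) (at y within J)" and lh': "M2-lipschitz_on J h'"
    unfolding lipschitz_smooth_on_def is_derivative_on_def by blast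
  have M: "0 \<le> M1" "0 \<le> M2"
    using lf lf' lipschitz_on_nonneg by blast+
  have b0: "0 < b" using a ab by simp
  have scaleI: "c * x \<in> I" if "x \<in> I" "0 < c" "c \<le> 1" for c x
  proof -
    have "\<bar>c * x\<bar> \<le> \<bar>x\<bar>"
      using that by (simp add: abs_mult mult_left_le_one_le)
    then show ?thesis
      using that(1) unfolding I_def by auto
  qed
  have aI: "a * x \<in> I" and bI: "b * x \<in> I" if "x \<in> I" for x
    using scaleI that a b0 ab b by auto
  have hf: "h (f x) = x" if "x \<in> I" for x
    using inj that by (simp add: h_def)
  have inj_dil: "inj_on (dilation f a) I"
  proof (rule inj_onI)
    fix x y assume xy: "x \<in> I" "y \<in> I" "dilation f a x = dilation f a y"
    then have "f (a * x) = f (a * y)"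
      using a by (simp add: dilation_def)
    then have "a * x = a * y"
      using inj_onD[OF inj] aI xy by blast
    then show "x = y"
      using a by simp
  qed
  have u_dil: "u (dilation f a x) = x" if "x \<in> I" for x
    using inj_dil that by (simp add: u_def)
  have D: "u y \<in> I" "a * y = f (a * u y)" if "y \<in> D" for y
  proof -
    from that obtain x where x: "x \<in> I" "y = dilation f a x"
      unfolding D_def by blast
    then show "u y \<in> I" "a * y = f (a * u y)"
      using a u_dil by (auto simp: dilation_def)
  qed
  have aJ: "a * y \<in> J" if "y \<in> D" for y
    using D[OF that] aI by (auto simp: J_def)
  have u_eq: "u y = h (a * y) / a" if "y \<in> D" for y
    using D[OF that] aI hf a by simp
  have contf: "continuous_on I f"
    using lf lipschitz_on_continuous_on by blast
  have "continuous_on I (dilation f a)"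
    unfolding dilation_def using a aI
    by (intro continuous_intros continuous_on_compose2[OF contf]) auto
  \<comment> \<open>A continuous image of an interval is an interval. Convexity is what later lets
    the mean value inequality turn bounds on derivatives into Lipschitz constants.\<close>
  then have "convex D"
    unfolding D_def
    by (intro is_interval_convex_1[THEN iffD1] is_interval_connected_1[THEN iffD2]
        connected_continuous_image) (simp_all add: I_def)
  have ntI: "at x within I \<noteq> bot" if "x \<in> I" for x
    using at_within_open[of x I] that by (simp add: I_def)
  \<comment> \<open>Openness of \<open>J\<close> is avoided: a connected set with two distinct
    points, here \<open>f 0\<close> and \<open>f (R / 2)\<close>, has no isolated points.\<close>
  have ntJ: "at y within J \<noteq> bot" if "y \<in> J" for y
  proof -
    have "connected J"
      unfolding J_def by (rule connected_continuous_image[OF contf]) (simp add: I_def)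
    moreover have "0 \<in> I" "R / 2 \<in> I"
      using R by (auto simp: I_def)
    then have "f 0 \<in> J" "f (R / 2) \<in> J" "f 0 \<noteq> f (R / 2)"
      using inj_onD[OF inj, of 0 "R / 2"] R by (auto simp: J_def)
    then have "J \<noteq> {z}" for z
      by auto
    ultimately show ?thesis
      using that connected_imp_perfect[of J y] by (auto simp: trivial_limit_within)
  qed
  have bf': "\<bar>f' x\<bar> \<le> M1" if "x \<in> I" for x
    using lipschitz_on_derivative_bound[OF lf f'] ntI that by blast
  have bh': "\<bar>h' y\<bar> \<le> M1" if "y \<in> J" for y
    using lipschitz_on_derivative_bound[OF lh h'] ntJ that by blast
  \<comment> \<open>Differentiate \<open>h (f x) = x\<close>; derivatives within the open set
    \<open>I\<close> are unique. The identity holds on all of \<open>I\<close>, so the radius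
    \<open>d=1\<close> below is arbitrary.\<close>
  have recip: "f' x * h' (f x) = 1" if "x \<in> I" for x
  proof -
    have "(h \<circ> f has_real_derivative h' (f x) * f' x) (at x within I)"
      using DERIV_image_chain[OF h'[of "f x", unfolded J_def] f'[OF that]] that by simp
    then have "((\<lambda>x. x) has_real_derivative h' (f x) * f' x) (at x within I)"
      by (rule has_field_derivative_transform_within[where d=1]) (use that hf in auto)
    moreover have "((\<lambda>x. x) has_real_derivative 1) (at x within I)"
      by (rule DERIV_ident)
    ultimately show ?thesis
      using at_within_open[of x I] that DERIV_unique[of "\<lambda>x. x" _ x]
      by (simp add: I_def mult.commute)
  qed
  define \<psi>' where "\<psi>' y = f' (b * u y) * h' (a * y) - 1" for y
  have du: "(u has_real_derivative h' (a * y)) (at y within D)" if y: "y \<in> D" for y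
  proof -
    have sub: "(*) a ` D \<subseteq> J"
      using aJ by blast
    have "((\<lambda>y. a * y) has_real_derivative a) (at y within D)"
      by (auto intro!: derivative_eq_intros)
    \<comment> \<open>The chain rule asks for the outer derivative within the image of
      \<open>D\<close>, so the derivative within \<open>J\<close> is restricted to that subset. The
      inner factor \<open>a\<close> then cancels against the division by \<open>a\<close>.\<close>
    from DERIV_image_chain[OF DERIV_subset[OF h' sub] this]
    have "(h \<circ> (\<lambda>y. a * y) has_real_derivative h' (a * y) * a) (at y within D)"
      using aJ[OF y] by simp
    then have "((\<lambda>y. (h \<circ> (\<lambda>y. a * y)) y / a) has_real_derivative h' (a * y) * a / a) (at y within D)"
      by (rule DERIV_cdivide)
    then have "((\<lambda>y. h (a * y) / a) has_real_derivative h' (a * y)) (at y within D)"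
      using a by (simp add: o_def)
    then show ?thesis
      by (rule has_field_derivative_transform_within[where d=1]) (use y u_eq in auto)
  qed
  have d\<psi>: "(\<psi> has_real_derivative \<psi>' y) (at y within D)" if y: "y \<in> D" for y
  proof -
    have sub: "(\<lambda>y. b * u y) ` D \<subseteq> I"
      using D(1) bI by blast
    have "((\<lambda>y. b * u y) has_real_derivative b * h' (a * y)) (at y within D)"
      using DERIV_cmult[OF du[OF y]] .
    from DERIV_image_chain[OF DERIV_subset[OF f' sub] this]
    have "(f \<circ> (\<lambda>y. b * u y) has_real_derivative f' (b * u y) * (b * h' (a * y))) (at y within D)"
      using D(1)[OF y] bI by simp
    then have "((\<lambda>y. (f \<circ> (\<lambda>y. b * u y)) y / b - y) has_real_derivative
        f' (b * u y) * (b * h' (a * y)) / b - 1) (at y within D)"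
      by (intro DERIV_diff DERIV_cdivide DERIV_ident)
    then show ?thesis
      using b0 by (simp add: \<psi>_def \<psi>'_def dilation_def o_def)
  qed
  have b\<psi>': "\<bar>\<psi>' y\<bar> \<le> M1 * M2 * R * (b - a)" if y: "y \<in> D" for y
  proof -
    have uI: "u y \<in> I" and ay: "a * y = f (a * u y)"
      using D[OF y] by auto
    \<comment> \<open>The 1 in \<open>\<psi>'\<close> is rewritten by \<open>recip\<close> at the
      point \<open>a * u y\<close>, whose image under \<open>f\<close> is
      \<open>a * y\<close>.\<close>
    have "\<psi>' y = (f' (b * u y) - f' (a * u y)) * h' (a * y)"
      using recip[OF aI[OF uI]] by (simp add: \<psi>'_def ay left_diff_distrib)
    then have "\<bar>\<psi>' y\<bar> = \<bar>f' (b * u y) - f' (a * u y)\<bar> * \<bar>h' (a * y)\<bar>"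
      by (simp add: abs_mult)
    also have "\<dots> \<le> (M2 * ((b - a) * R)) * M1"
    proof (intro mult_mono bh' aJ y)
      have "\<bar>f' (b * u y) - f' (a * u y)\<bar> \<le> M2 * \<bar>b * u y - a * u y\<bar>"
        using lipschitz_onD[OF lf' bI[OF uI] aI[OF uI]] by (simp add: dist_real_def)
      also have "\<bar>b * u y - a * u y\<bar> = (b - a) * \<bar>u y\<bar>"
        using ab by (simp add: left_diff_distrib[symmetric] abs_mult)
      also have "M2 * ((b - a) * \<bar>u y\<bar>) \<le> M2 * ((b - a) * R)"
        using M ab uI by (intro mult_left_mono) (auto simp: I_def)
      finally show "\<bar>f' (b * u y) - f' (a * u y)\<bar> \<le> M2 * ((b - a) * R)" .
    qed (use M ab R in auto)
    finally show ?thesis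
      by (simp add: mult_ac)
  qed
  have "0 \<le> M1 * M2 * R * (b - a)"
    using M R ab by simp
  then have "(M1 * M2 * R * (b - a))-lipschitz_on D \<psi>"
    using field_differentiable_bound[OF \<open>convex D\<close> d\<psi>, of "M1 * M2 * R * (b - a)"] b\<psi>'
    by (intro lipschitz_onI) (auto simp: dist_norm)
  then show "(3 * M1 * M2 * R * (b - a))-lipschitz_on D \<psi>"
    by (rule lipschitz_on_le) (use \<open>0 \<le> M1 * M2 * R * (b - a)\<close> in simp)
  \<comment> \<open>The derivative of \<open>u\<close> at \<open>y\<close> is
    \<open>h' (a * y)\<close>, so the constant is free of \<open>1 / a\<close>.\<close>
  have lu: "M1-lipschitz_on D u"
    using field_differentiable_bound[OF \<open>convex D\<close> du, of M1] bh' aJ M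
    by (intro lipschitz_onI) (auto simp: dist_norm)
  \<comment> \<open>The factors come from the Lipschitz constants of \<open>f'\<close>
    (\<open>M2\<close>), of scaling by \<open>b\<close>, and of \<open>u\<close>
    (\<open>M1\<close>).\<close>
  have l1: "(b * M1 * M2)-lipschitz_on D (\<lambda>y. f' (b * u y))"
  proof (rule lipschitz_onI)
    fix x y assume xy: "x \<in> D" "y \<in> D"
    have "\<bar>f' (b * u x) - f' (b * u y)\<bar> \<le> M2 * \<bar>b * u x - b * u y\<bar>"
      using lipschitz_onD[OF lf', of "b * u x" "b * u y"] bI D(1) xy by (simp add: dist_real_def)
    also have "\<dots> = M2 * (b * \<bar>u x - u y\<bar>)"
      using b0 by (simp add: right_diff_distrib[symmetric] abs_mult)
    also have "\<dots> \<le> M2 * (b * (M1 * \<bar>x - y\<bar>))"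
      using lipschitz_onD[OF lu xy] M b0 by (intro mult_left_mono) (auto simp: dist_real_def)
    finally show "dist (f' (b * u x)) (f' (b * u y)) \<le> b * M1 * M2 * dist x y"
      by (simp add: dist_real_def mult_ac)
  qed (use M b0 in simp)
  have l2: "(a * M2)-lipschitz_on D (\<lambda>y. h' (a * y))"
  proof (rule lipschitz_onI)
    fix x y assume xy: "x \<in> D" "y \<in> D"
    have "\<bar>h' (a * x) - h' (a * y)\<bar> \<le> M2 * \<bar>a * x - a * y\<bar>"
      using lipschitz_onD[OF lh', of "a * x" "a * y"] aJ xy by (simp add: dist_real_def)
    also have "\<bar>a * x - a * y\<bar> = a * \<bar>x - y\<bar>"
      using a by (simp add: right_diff_distrib[symmetric] abs_mult)
    finally show "dist (h' (a * x)) (h' (a * y)) \<le> a * M2 * dist x y"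
      by (simp add: dist_real_def mult_ac)
  qed (use M a in simp)
  have "(b * M1 * M2 * M1 + M1 * (a * M2))-lipschitz_on D (\<lambda>y. f' (b * u y) * h' (a * y))"
    using bf' bh' bI D(1) aJ M by (intro lipschitz_on_mult_bounded[OF l1 l2]) auto
  then have "(b * M1 * M2 * M1 + M1 * (a * M2))-lipschitz_on D \<psi>'"
    by (simp add: lipschitz_on_def dist_real_def \<psi>'_def)
  then have "(M2 * (M1\<^sup>2 + M1))-lipschitz_on D \<psi>'"
  proof (rule lipschitz_on_le)
    have "b * (M1 * M2 * M1) + a * (M1 * M2) \<le> 1 * (M1 * M2 * M1) + 1 * (M1 * M2)"
      using M ab b by (intro add_mono mult_right_mono) auto
    then show "b * M1 * M2 * M1 + M1 * (a * M2) \<le> M2 * (M1\<^sup>2 + M1)"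
      by (simp add: power2_eq_square algebra_simps)
  qed
  with d\<psi> show "lipschitz_smooth_on (M2 * (M1\<^sup>2 + M1)) D \<psi>"
    unfolding lipschitz_smooth_on_def is_derivative_on_def by blast
qed

theorem theorem1:
  fixes R M1 M2 C1 C2 :: real and d :: nat and \<gamma> :: "nat \<Rightarrow> real" and f :: "real \<Rightarrow> real"
  assumes "R > 0"
    and "d \<ge> 1"
    and "0 < \<gamma> 0"
    and "\<forall>k<d. \<gamma> k < \<gamma> (Suc k)"
    and "\<gamma> d = 1"
    and "diffeomorphism_on_interval M1 M2 R f"
    and "C1 = 3 * M1 * M2"
    and "C2 = M2 * (M1\<^sup>2 + M1)"
  shows "\<forall>k\<in>{1..d}.
           (C1 * R * (\<gamma> k - \<gamma> (k - 1)))-lipschitz_on (Dom R f \<gamma> k) (psi R f \<gamma> k) \<and>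
           lipschitz_smooth_on C2 (Dom R f \<gamma> k) (psi R f \<gamma> k)"
proof
  fix k assume "k \<in> {1..d}"
  then obtain j where k: "k = Suc j" and "j < d"
    by (cases k) auto
  have lo: "\<gamma> 0 \<le> \<gamma> n" if "n \<le> d" for n
    using that
  proof (induction n)
    case (Suc n)
    then show ?case
      using assms(4) by (force simp: Suc_le_eq)
  qed simp
  \<comment> \<open>Induction downwards from \<open>d\<close>, since the upper bound is known only
    at that end.\<close>
  have hi: "\<gamma> n \<le> \<gamma> d" if "n \<le> d" for n
    using that
  proof (induction n rule: inc_induct)
    case (step n)
    then show ?case
      using assms(4) by force
  qed simp
  have "0 < \<gamma> j" "\<gamma> j \<le> \<gamma> k" "\<gamma> k \<le> 1"
    using lo[of j] hi[of k] assms(3,4,5) \<open>j < d\<close> k less_imp_le by auto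
  note quot = dilation_quotient[OF \<open>R > 0\<close> this assms(6)]
  \<comment> \<open>Since \<open>k = Suc j\<close>, the natural number \<open>k - 1\<close> is
    exactly \<open>j\<close> and nothing is truncated.\<close>
  have "psi R f \<gamma> k = (\<lambda>y. dilation f (\<gamma> k) (inv_into {-R<..<R} (dilation f (\<gamma> j)) y) - y)"
    by (simp add: fun_eq_iff psi_def Delta_def k)
  then show "(C1 * R * (\<gamma> k - \<gamma> (k - 1)))-lipschitz_on (Dom R f \<gamma> k) (psi R f \<gamma> k) \<and>
      lipschitz_smooth_on C2 (Dom R f \<gamma> k) (psi R f \<gamma> k)"
    using quot by (simp add: Dom_def k assms(7,8))
qed

end
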